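(* Let $f:\mathbb{Z}^4\to\mathbb{C}$ be a $C^+$ lattice with labelling $\alpha$ and edges $d^i=f_i-f$, and let $p^i=\begin{pmatrix}0&d^i\\-(\alpha^i)^2/d^i&0\end{pmatrix}$. Let $\lambda=e^{\mathrm{i}t}\in\mathbb{S}^1$, $t\in\mathbb{R}$, let $\Phi$ be the frame with $\Phi_i=(\lambda+\frac1\lambda p^i)\Phi$ and initial value $\Phi(\mathbf{0},t)\in\mathbb{H}$, and let $f_t=\Phi^{-1}\Phi'$, with $'$ the derivative with respect to $t$, be the associated family (so that $f_t(\mathbf{0})\in\mathbb{H}$). Then the points $f_t(x)$ of the diagonal net, $x\in D=\{(i,j,i,j):i,j\in\mathbb{Z}\}$, are quaternions.
   Context: Quaternions are identified with the real subalgebra $\mathbb{H}=\left\{\begin{pmatrix}a&b\\-\bar b&\bar a\end{pmatrix}:a,b\in\mathbb{C}\right\}\subset\mathbb{C}^{2\times2}$. A scalar stands for the corresponding multiple of the identity matrix; $\mathbb{S}^1$ is the unit circle in $\mathbb{C}$. For maps on $\mathbb{Z}^4$ write $f=f(x)$, $f_i=f(x+e_i)$, $f_{ij}=f(x+e_i+e_j)$; edge based maps have values $\alpha^i=\alpha^i(x)$ on the edge $(x,x+e_i)$ and $\alpha^i_j=\alpha^i(x+e_j)$. A cross-ratio system is a map $f:\mathbb{Z}^4\to\mathbb{C}$ (with the four points of each quad pairwise distinct) together with an edge labelling $\alpha$ with values in $\mathbb{C}\setminus\{0\}$, $\alpha^i_j=\alpha^i$ for $i\neq j$, such that with $d^i=f_i-f$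 one has $\frac{d^id^i_j}{d^jd^j_i}=\frac{(\alpha^i)^2}{(\alpha^j)^2}$ for $i\ne j$. Its map $s:\mathbb{Z}^4\to\mathbb{C}$ is defined by $s(\mathbf{0})=1$, $d^i=\alpha^is_is$. The cross-ratio system is a $C^+$ lattice if for every $x\in D$: $s_1(x)\bar s_3(x)=1$, $s_2(x)\bar s_4(x)=1$, $\alpha^1(x)\bar\alpha^3(x)=-1$, $\alpha^2(x)\bar\alpha^4(x)=-1$. The frame $\Phi$ depends on the vertex and (differentiably) on $t$; as usual for the associated family, $\Phi$ is assumed invertible at the parameters $t$ considered. *)

theory Defs
  imports "HOL-Analysis.Analysis"
begin

text \<open>
  Points of the lattice have type \<^typ>\<open>int ^ 4\<close>, with coordinates \<open>x $ 1, \<dots>, x $ 4\<close> (in the index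
  type, \<open>4\<close> and \<open>0\<close> denote the same element).  The value of an edge map on the edge from \<open>x\<close> to
  \<open>x + e i\<close> is written \<open>\<alpha> i x\<close>.
\<close>

abbreviation e :: "4 \<Rightarrow> int ^ 4" where
  "e i \<equiv> axis i 1"

definition diagonal :: "(int ^ 4) set" where
  "diagonal = {x. \<exists>i j. x = vector [i, j, i, j]}"

definition quaternions :: "(complex ^ 2 ^ 2) set" where
  "quaternions = {vector [vector [a, b], vector [- cnj b, cnj a]] | a b. True}"

definition edge :: "(int ^ 4 \<Rightarrow> complex) \<Rightarrow> 4 \<Rightarrow> int ^ 4 \<Rightarrow> complex" where
  "edge f i x = f (x + e i) - f x"

definition cross_ratio_system ::
  "(int ^ 4 \<Rightarrow> complex) \<Rightarrow> (4 \<Rightarrow> int ^ 4 \<Rightarrow> complex) \<Rightarrow> bool" where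
  "cross_ratio_system f \<alpha> \<longleftrightarrow>
     (\<forall>x i j. i \<noteq> j \<longrightarrow> distinct [f x, f (x + e i), f (x + e j), f (x + e i + e j)]) \<and>
     (\<forall>x i. \<alpha> i x \<noteq> 0) \<and>
     (\<forall>x i j. i \<noteq> j \<longrightarrow> \<alpha> i (x + e j) = \<alpha> i x) \<and>
     (\<forall>x i j. i \<noteq> j \<longrightarrow>
        (edge f i x * edge f i (x + e j)) / (edge f j x * edge f j (x + e i))
          = (\<alpha> i x)\<^sup>2 / (\<alpha> j x)\<^sup>2)"

definition s_map ::
  "(int ^ 4 \<Rightarrow> complex) \<Rightarrow> (4 \<Rightarrow> int ^ 4 \<Rightarrow> complex) \<Rightarrow> (int ^ 4 \<Rightarrow> complex) \<Rightarrow> bool" where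
  "s_map f \<alpha> s \<longleftrightarrow> s 0 = 1 \<and> (\<forall>x i. edge f i x = \<alpha> i x * s (x + e i) * s x)"

text \<open>
  For a cross-ratio system there is exactly one \<open>s\<close> with \<open>s_map f \<alpha> s\<close>: all edges and labels are
  nonzero, so \<open>s\<close> is determined along lattice paths from \<open>0\<close>, and the cross-ratio condition is
  what makes it path independent.  The existential quantifier below merely names this map.
\<close>

definition C_plus_lattice ::
  "(int ^ 4 \<Rightarrow> complex) \<Rightarrow> (4 \<Rightarrow> int ^ 4 \<Rightarrow> complex) \<Rightarrow> bool" where
  "C_plus_lattice f \<alpha> \<longleftrightarrow> cross_ratio_system f \<alpha> \<and>
     (\<exists>s. s_map f \<alpha> s \<and>
       (\<forall>x\<in>diagonal.
          s (x + e 1) * cnj (s (x + e 3)) = 1 \<and>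
          s (x + e 2) * cnj (s (x + e 4)) = 1 \<and>
          \<alpha> 1 x * cnj (\<alpha> 3 x) = -1 \<and>
          \<alpha> 2 x * cnj (\<alpha> 4 x) = -1))"

definition p_matrix ::
  "(int ^ 4 \<Rightarrow> complex) \<Rightarrow> (4 \<Rightarrow> int ^ 4 \<Rightarrow> complex) \<Rightarrow> 4 \<Rightarrow> int ^ 4 \<Rightarrow> complex ^ 2 ^ 2" where
  "p_matrix f \<alpha> i x =
     vector [vector [0, edge f i x], vector [- (\<alpha> i x)\<^sup>2 / edge f i x, 0]]"

definition transition ::
  "(int ^ 4 \<Rightarrow> complex) \<Rightarrow> (4 \<Rightarrow> int ^ 4 \<Rightarrow> complex) \<Rightarrow> 4 \<Rightarrow> int ^ 4 \<Rightarrow> real \<Rightarrow> complex ^ 2 ^ 2" where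
  "transition f \<alpha> i x t = mat (cis t) + mat (1 / cis t) ** p_matrix f \<alpha> i x"

text \<open>
  A transition matrix is singular where \<open>cis t ^ 4 = - (\<alpha> i x)\<^sup>2\<close>, so an invertible frame need not
  exist for all real parameters, and these exceptional parameters may even accumulate.  The frame
  equation is therefore required, for each edge, only near the parameter \<open>t\<close> under consideration;
  this suffices for the \<open>t\<close>-derivatives at \<open>t\<close>.  A differentiable frame on a whole interval
  (or on all of the real line) is a frame at each of its interior points \<open>t\<close> at which it is
  invertible.
\<close>

definition frame_at ::
  "(int ^ 4 \<Rightarrow> complex) \<Rightarrow> (4 \<Rightarrow> int ^ 4 \<Rightarrow> complex) \<Rightarrow> (int ^ 4 \<Rightarrow> real \<Rightarrow> complex ^ 2 ^ 2)
     \<Rightarrow> real \<Rightarrow> bool" where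
  "frame_at f \<alpha> \<Phi> t \<longleftrightarrow>
     (\<forall>x i. \<forall>\<^sub>F \<tau> in nhds t. \<Phi> (x + e i) \<tau> = transition f \<alpha> i x \<tau> ** \<Phi> x \<tau>) \<and>
     (\<forall>x. \<Phi> x differentiable (at t)) \<and>
     (\<forall>x. invertible (\<Phi> x t))"

definition associated_family ::
  "(int ^ 4 \<Rightarrow> real \<Rightarrow> complex ^ 2 ^ 2) \<Rightarrow> real \<Rightarrow> int ^ 4 \<Rightarrow> complex ^ 2 ^ 2" where
  "associated_family \<Phi> t x = matrix_inv (\<Phi> x t) ** vector_derivative (\<Phi> x) (at t)"

end

theory Submission
  imports Defs
begin

text \<open>
  Along the diagonal the frame is quaternionic only up to a gauge: \<open>\<Phi> x\<close> lies in \<open>diag(1, k) H\<close> for a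
  constant \<open>k\<close> that depends on \<open>x\<close> but not on the parameter, and such a constant left factor cancels in
  \<open>\<Phi>\<^sup>-\<^sup>1 \<Phi>'\<close>.  The gauge is propagated by induction over the diagonal, in both directions.  The closing
  condition of the quad spanned by directions 1 and 3 (or 2 and 4), together with the \<open>C\<^sup>+\<close> relations on
  \<open>s\<close> and \<open>\<alpha>\<close>, keeps \<open>s\<close> real on the diagonal; and if \<open>\<bar>k s\<bar> = 1\<close>, the product of the two transition
  matrices maps \<open>diag(1, k) H\<close> to \<open>diag(1, k') H\<close>, where \<open>k' = - k \<alpha>\<^sup>1 \<alpha>\<^sup>3 s / s\<^sub>1\<^sub>3\<close> and again \<open>\<bar>k' s\<^sub>1\<^sub>3\<bar> = 1\<close>.
\<close>

section \<open>Quaternionic matrices up to a constant left gauge\<close>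

text \<open>Membership in \<open>diag(1, k) H\<close>.\<close>
definition twisted :: "complex \<Rightarrow> complex ^ 2 ^ 2 \<Rightarrow> bool" where
  "twisted k M \<longleftrightarrow> M $ 2 $ 1 = - k * cnj (M $ 1 $ 2) \<and> M $ 2 $ 2 = k * cnj (M $ 1 $ 1)"

lemma quaternions_iff_twisted: "M \<in> quaternions \<longleftrightarrow> twisted 1 M"
proof
  assume "twisted 1 M"
  then have "M = vector [vector [M $ 1 $ 1, M $ 1 $ 2], vector [- cnj (M $ 1 $ 2), cnj (M $ 1 $ 1)]]"
    by (simp add: twisted_def vec_eq_iff forall_2)
  then show "M \<in> quaternions"
    unfolding quaternions_def by blast
qed (auto simp: quaternions_def twisted_def)

text \<open>The first two hypotheses say that \<open>M diag(1, k)\<close> lies in \<open>diag(1, k') H\<close>.\<close>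
lemma twisted_mult_iff:
  assumes m22: "k * M $ 2 $ 2 = k' * cnj (M $ 1 $ 1)"
    and m21: "M $ 2 $ 1 = - k' * cnj (k * M $ 1 $ 2)"
    and inv: "invertible M"
  shows "twisted k' (M ** X) \<longleftrightarrow> twisted k X"
proof -
  \<comment> \<open>\<open>\<delta>\<close> and \<open>\<epsilon>\<close> measure the failure of
    \<open>twisted k X\<close>; the corresponding defects of \<open>M ** X\<close> turn out to be
    combinations of these and their conjugates.\<close>
  define \<delta> \<epsilon> where "\<delta> = X $ 2 $ 1 + k * cnj (X $ 1 $ 2)"
    and "\<epsilon> = X $ 2 $ 2 - k * cnj (X $ 1 $ 1)"
  define m w where "m = M $ 2 $ 2" and "w = k' * cnj (M $ 1 $ 2)"
  have 1: "(M ** X) $ 2 $ 1 + k' * cnj ((M ** X) $ 1 $ 2) = m * \<delta> + w * cnj \<epsilon>"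
  proof -
    have "(M ** X) $ 2 $ 1 + k' * cnj ((M ** X) $ 1 $ 2) =
        M $ 2 $ 1 * X $ 1 $ 1 + m * X $ 2 $ 1 + (k' * cnj (M $ 1 $ 1)) * cnj (X $ 1 $ 2)
          + w * cnj (X $ 2 $ 2)"
      by (simp add: matrix_matrix_mult_def sum_2 m_def w_def algebra_simps)
    then show ?thesis
      unfolding m22[symmetric] m21 by (simp add: \<delta>_def \<epsilon>_def m_def w_def algebra_simps)
  qed
  have 2: "(M ** X) $ 2 $ 2 - k' * cnj ((M ** X) $ 1 $ 1) = m * \<epsilon> - w * cnj \<delta>"
  proof -
    have "(M ** X) $ 2 $ 2 - k' * cnj ((M ** X) $ 1 $ 1) =
        M $ 2 $ 1 * X $ 1 $ 2 + m * X $ 2 $ 2 - (k' * cnj (M $ 1 $ 1)) * cnj (X $ 1 $ 1)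
          - w * cnj (X $ 2 $ 1)"
      by (simp add: matrix_matrix_mult_def sum_2 m_def w_def algebra_simps)
    then show ?thesis
      unfolding m22[symmetric] m21 by (simp add: \<delta>_def \<epsilon>_def m_def w_def algebra_simps)
  qed
  \<comment> \<open>If both vanished, so would the second row of \<open>M\<close>, because
    \<open>m21\<close> gives \<open>M $ 2 $ 1 = - cnj k * w\<close>.\<close>
  have "m \<noteq> 0 \<or> w \<noteq> 0"
    using inv m21 by (auto simp: invertible_det_nz det_2 m_def w_def)
  then have pos: "(cmod m)\<^sup>2 + (cmod w)\<^sup>2 \<noteq> 0"
    by (simp add: sum_power2_eq_zero_iff)
  \<comment> \<open>Elimination between the system and its conjugate; the determinant is
    \<open>|m|^2 + |w|^2\<close>.\<close>
  have zero: "\<delta> = 0 \<and> \<epsilon> = 0" if "m * \<delta> + w * cnj \<epsilon> = 0" "m * \<epsilon> - w * cnj \<delta> = 0"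
  proof -
    have c1: "cnj m * cnj \<delta> + cnj w * \<epsilon> = 0" and c2: "cnj m * cnj \<epsilon> - cnj w * \<delta> = 0"
      using that[THEN arg_cong[where f = cnj]] by simp_all
    have "(m * cnj m + w * cnj w) * \<delta>
        = cnj m * (m * \<delta> + w * cnj \<epsilon>) - w * (cnj m * cnj \<epsilon> - cnj w * \<delta>)"
      "(m * cnj m + w * cnj w) * \<epsilon>
        = cnj m * (m * \<epsilon> - w * cnj \<delta>) + w * (cnj m * cnj \<delta> + cnj w * \<epsilon>)"
      by (simp_all add: algebra_simps)
    moreover have "m * cnj m + w * cnj w \<noteq> 0"
      using pos by (metis complex_norm_square of_real_add of_real_eq_0_iff)
    ultimately show ?thesis
      unfolding that c1 c2 by simp
  qed
  have "twisted k' (M ** X) \<longleftrightarrow> m * \<delta> + w * cnj \<epsilon> = 0 \<and> m * \<epsilon> - w * cnj \<delta> = 0"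
    unfolding 1[symmetric] 2[symmetric] by (simp add: twisted_def eq_neg_iff_add_eq_0)
  also have "\<dots> \<longleftrightarrow> \<delta> = 0 \<and> \<epsilon> = 0"
    using zero by auto
  also have "\<dots> \<longleftrightarrow> twisted k X"
    by (simp add: twisted_def \<delta>_def \<epsilon>_def eq_neg_iff_add_eq_0)
  finally show ?thesis .
qed

section \<open>Quads and products of two transition matrices\<close>

lemma transition_eq:
  assumes "edge f i x = \<alpha> i x * s (x + e i) * s x" "\<alpha> i x \<noteq> 0"
  shows "transition f \<alpha> i x \<tau> = vector
    [vector [cis \<tau>, \<alpha> i x * s (x + e i) * s x / cis \<tau>],
     vector [- \<alpha> i x / (s (x + e i) * s x) / cis \<tau>, cis \<tau>]]"
  using assms
  by (simp add: transition_def p_matrix_def vec_eq_iff forall_2 matrix_matrix_mult_def sum_2 mat_def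
      power2_eq_square)

text \<open>The left side is \<open>|a * b|^2\<close>, which equals
  \<open>|a * cnj b|^2\<close>.\<close>

lemma mult_cnj_mult_eq_1:
  assumes "a * cnj b = -1"
  shows "a * b * (cnj a * cnj b) = 1"
proof -
  have "a * b * (cnj a * cnj b) = (a * cnj b) * cnj (a * cnj b)"
    by (simp only: complex_cnj_mult complex_cnj_cnj mult_ac)
  then show ?thesis
    unfolding assms by simp
qed

text \<open>The closing condition is multiplied by \<open>cnj si\<close>, which by
  \<open>dual\<close> is the inverse of \<open>sj\<close>.\<close>

lemma quad_relation:
  fixes a b :: complex
  assumes closed: "a * si * s + b * sij * si = b * sj * s + a * sij * sj"
    and dual: "si * cnj sj = 1"
  shows "si * cnj si * (a * s + b * sij) = b * s + a * sij"
proof -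
  have "sj * cnj si = 1"
    using dual[THEN arg_cong[where f = cnj]] by (simp add: mult.commute)
  moreover have "cnj si * (a * si * s + b * sij * si) = (sj * cnj si) * (b * s + a * sij)"
    unfolding closed by (simp add: algebra_simps)
  ultimately show ?thesis
    by (simp add: algebra_simps)
qed

text \<open>Multiplied by \<open>cnj a\<close>, the relation becomes
  \<open>(1 + A * N) * s = (A + N) * sij\<close>, so \<open>s\<close> and \<open>sij\<close> differ
  by a positive real factor.\<close>

lemma quad_real_iff:
  fixes a b :: complex
  assumes rel: "si * cnj si * (a * s + b * sij) = b * s + a * sij"
    and ab: "a * cnj b = -1"
  shows "s \<in> \<real> \<longleftrightarrow> sij \<in> \<real>"
proof -
  define N A where "N = (cmod si)\<^sup>2" and "A = (cmod a)\<^sup>2"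
  have N: "si * cnj si = of_real N" and A: "a * cnj a = of_real A"
    by (simp_all only: N_def A_def complex_norm_square)
  have ba: "b * cnj a = -1"
    using ab[THEN arg_cong[where f = cnj]] by (simp add: mult.commute)
  have "a \<noteq> 0"
    using ab by auto
  then have pos: "A > 0" "N \<ge> 0"
    by (simp_all add: A_def N_def)
  have "of_real N * (a * cnj a * s + b * cnj a * sij) = b * cnj a * s + a * cnj a * sij"
    using rel[THEN arg_cong[where f = "\<lambda>z. cnj a * z"]] unfolding N by (simp add: algebra_simps)
  then have eq: "of_real (1 + A * N) * s = of_real (A + N) * sij"
    unfolding A ba by (simp add: algebra_simps)
  have nz: "1 + A * N \<noteq> 0" "A + N \<noteq> 0"
    using pos by (smt (verit) mult_nonneg_nonneg)+
  have "s \<in> \<real> \<longleftrightarrow> of_real (1 + A * N) * s \<in> \<real>"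
    using nz by (simp del: of_real_add add: complex_is_Real_iff)
  also have "\<dots> \<longleftrightarrow> sij \<in> \<real>"
    unfolding eq using nz by (simp del: of_real_add add: complex_is_Real_iff)
  finally show ?thesis .
qed

text \<open>As \<open>cnj L = 1 / L\<close>, conjugation swaps the powers of \<open>L\<close> in the
  diagonal entries, and \<open>|a * b| = 1\<close> matches their coefficients. The off-diagonal
  entries are free of \<open>L\<close> and match by \<open>rel\<close>. Hence \<open>k'\<close> does
  not depend on \<open>L\<close>. The last claim restores the normalisation at the opposite vertex,
  so that the step can be iterated.\<close>

lemma two_step_twisted:
  fixes a b k L :: complex
  assumes rel: "si * cnj si * (a * s + b * sij) = b * s + a * sij"
    and ab: "a * cnj b = -1"
    and real: "s \<in> \<real>" "sij \<in> \<real>"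
    and nz: "s \<noteq> 0" "si \<noteq> 0" "sij \<noteq> 0"
    and k: "k * cnj k * s\<^sup>2 = 1"
    and L: "L * cnj L = 1"
  defines "k' \<equiv> - k * (a * b) * s / sij"
    and "M \<equiv> (vector [vector [L, b * sij * si / L], vector [- b / (sij * si) / L, L]] :: complex ^ 2 ^ 2)
      ** (vector [vector [L, a * si * s / L], vector [- a / (si * s) / L, L]] :: complex ^ 2 ^ 2)"
  shows "k * M $ 2 $ 2 = k' * cnj (M $ 1 $ 1)"
    and "M $ 2 $ 1 = - k' * cnj (k * M $ 1 $ 2)"
    and "k' * cnj k' * sij\<^sup>2 = 1"
proof -
  have L0: "L \<noteq> 0"
    using L by auto
  then have cL: "cnj L = 1 / L"
    using L by (simp add: eq_divide_eq mult.commute)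
  have r: "cnj s = s" "cnj sij = sij"
    using real by (simp_all add: Reals_cnj_iff)
  have ba: "b * cnj a = -1"
    using ab[THEN arg_cong[where f = cnj]] by (simp add: mult.commute)
  have abab: "a * b * (cnj a * cnj b) = 1"
    by (rule mult_cnj_mult_eq_1[OF ab])
  have m11: "M $ 1 $ 1 = L\<^sup>2 - a * b * sij / (s * L\<^sup>2)"
    and m22: "M $ 2 $ 2 = L\<^sup>2 - a * b * s / (sij * L\<^sup>2)"
    and m12: "M $ 1 $ 2 = si * (a * s + b * sij)"
    and m21: "M $ 2 $ 1 = - (b * s + a * sij) / (si * s * sij)"
    using nz L0 by (simp_all add: M_def matrix_matrix_mult_def sum_2 field_simps power2_eq_square)
  show "k * M $ 2 $ 2 = k' * cnj (M $ 1 $ 1)"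
  proof -
    have "k' * cnj (M $ 1 $ 1)
        = - k * (a * b) * s / (sij * L\<^sup>2) + k * (a * b * (cnj a * cnj b)) * L\<^sup>2"
      using nz L0 by (simp add: m11 k'_def r cL field_simps)
    then show ?thesis
      unfolding abab m22 by (simp add: algebra_simps)
  qed
  show "M $ 2 $ 1 = - k' * cnj (k * M $ 1 $ 2)"
  proof -
    \<comment> \<open>The factors are grouped so that \<open>k * cnj k * s\<^sup>2\<close>,
      \<open>b * cnj a\<close> and \<open>a * cnj b\<close> become 1, -1 and -1.\<close>
    have "- k' * cnj (k * M $ 1 $ 2)
        = (k * cnj k * s\<^sup>2) * (b * (a * cnj a * s) + a * (b * cnj b * sij)) * cnj si / (s * sij)"
      using nz by (simp add: m12 k'_def r field_simps power2_eq_square)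
    also have "b * (a * cnj a * s) + a * (b * cnj b * sij) = (b * cnj a) * (a * s) + (a * cnj b) * (b * sij)"
      by (simp add: algebra_simps)
    also have "(k * cnj k * s\<^sup>2) * \<dots> * cnj si / (s * sij) = - (si * cnj si * (a * s + b * sij)) / (si * s * sij)"
      unfolding k ab ba using nz by (simp add: field_simps)
    finally show ?thesis
      unfolding rel m21 by simp
  qed
  have "k' * cnj k' * sij\<^sup>2 = (k * cnj k * s\<^sup>2) * (a * b * (cnj a * cnj b))"
    using nz by (simp add: k'_def r field_simps power2_eq_square)
  then show "k' * cnj k' * sij\<^sup>2 = 1"
    by (simp only: k abab mult_1)
qed

section \<open>Dependence on the parameter\<close>

text \<open>For constant \<open>k\<close> the conditions are real-linear in the entries, and
  conjugation commutes with differentiation in a real parameter.\<close>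

lemma twisted_derivative:
  assumes ev: "\<forall>\<^sub>F \<tau> in nhds t. twisted k (\<Psi> \<tau>)"
    and D: "(\<Psi> has_vector_derivative D) (at t)"
  shows "twisted k D"
proof -
  have comp: "((\<lambda>\<tau>. \<Psi> \<tau> $ i $ j) has_vector_derivative D $ i $ j) (at t)" for i j
    using D by (intro bounded_linear.has_vector_derivative[OF bounded_linear_vec_nth])
  have cnj: "((\<lambda>\<tau>. c * cnj (\<Psi> \<tau> $ i $ j)) has_vector_derivative c * cnj (D $ i $ j)) (at t)" for c i j
    by (intro bounded_linear.has_vector_derivative[OF bounded_linear_mult_right]
        bounded_linear.has_vector_derivative[OF bounded_linear_cnj] comp)
  have eqI: "x = y" if "\<forall>\<^sub>F \<tau> in nhds t. g \<tau> = h \<tau>" "(g has_vector_derivative x) (at t)"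
    "(h has_vector_derivative y) (at t)" for g h :: "real \<Rightarrow> complex" and x y
  proof -
    have "(g has_vector_derivative y) (at t)"
      using that(1,3) eventually_nhds_x_imp_x[OF that(1)] 
        has_vector_derivative_cong_ev[where S = UNIV and f = g and g = h and x = t]
      by simp
    with that(2) show ?thesis
      by (rule vector_derivative_unique_at)
  qed
  have "D $ 2 $ 1 = - k * cnj (D $ 1 $ 2)"
    by (rule eqI[OF _ comp cnj], rule eventually_mono[OF ev]) (simp add: twisted_def)
  moreover have "D $ 2 $ 2 = k * cnj (D $ 1 $ 1)"
    by (rule eqI[OF _ comp cnj], rule eventually_mono[OF ev]) (simp add: twisted_def)
  ultimately show ?thesis
    by (simp add: twisted_def)
qed

lemma matrix_inv_right:
  assumes "invertible A"
  shows "A ** matrix_inv A = mat 1"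
  using someI_ex[OF assms[unfolded invertible_def]] unfolding matrix_inv_def by (rule conjunct1)

text \<open>Invertibility of the frame is given only at \<open>t\<close>, but the gauge is
  transported on a neighbourhood; continuity of the determinant bridges this.\<close>

lemma eventually_invertible:
  fixes \<Psi> :: "real \<Rightarrow> complex ^ 2 ^ 2"
  assumes "isCont \<Psi> t" "invertible (\<Psi> t)"
  shows "\<forall>\<^sub>F \<tau> in nhds t. invertible (\<Psi> \<tau>)"
proof -
  have "isCont (\<lambda>\<tau>. det (\<Psi> \<tau>)) t"
    unfolding det_2 using assms(1) by (intro continuous_intros) auto
  then have "\<forall>\<^sub>F \<tau> in at t. det (\<Psi> \<tau>) \<noteq> 0"
    using assms(2) unfolding isCont_def invertible_det_nz by (rule tendsto_imp_eventually_ne)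
  then show ?thesis
    using assms(2) unfolding invertible_det_nz eventually_at_filter by (auto elim: eventually_mono)
qed

section \<open>Transport of the gauge along the diagonal net\<close>

text \<open>An equivalence as step covers the upward and the downward direction from 0 at
  once.\<close>

lemma int_iff_Suc_induct:
  fixes n :: int
  assumes "P 0" "\<And>n. P n \<longleftrightarrow> P (n + 1)"
  shows "P n"
  by (induction n rule: int_induct[where k = 0]) (use assms in \<open>auto simp: assms(2)[of "_ - 1"]\<close>)

lemma vector_4:
  fixes a b c d :: "'a :: zero"
  shows "(vector [a, b, c, d] :: 'a ^ 4) $ 1 = a" "(vector [a, b, c, d] :: 'a ^ 4) $ 2 = b"
    "(vector [a, b, c, d] :: 'a ^ 4) $ 3 = c" "(vector [a, b, c, d] :: 'a ^ 4) $ 4 = d"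
  by (simp_all add: vector_def)

theorem proposition4p8:
  fixes f :: "int ^ 4 \<Rightarrow> complex"
    and \<alpha> :: "4 \<Rightarrow> int ^ 4 \<Rightarrow> complex"
    and \<Phi> :: "int ^ 4 \<Rightarrow> real \<Rightarrow> complex ^ 2 ^ 2"
    and t :: real
  assumes "C_plus_lattice f \<alpha>"
    and "frame_at f \<alpha> \<Phi> t"
    and "\<forall>\<^sub>F \<tau> in nhds t. \<Phi> 0 \<tau> \<in> quaternions"
  shows "\<forall>x\<in>diagonal. associated_family \<Phi> t x \<in> quaternions"
proof -
  obtain s where cr: "cross_ratio_system f \<alpha>" and s: "s_map f \<alpha> s"
    and diag: "\<And>x. x \<in> diagonal \<Longrightarrow> s (x + e 1) * cnj (s (x + e 3)) = 1
      \<and> s (x + e 2) * cnj (s (x + e 4)) = 1 \<and> \<alpha> 1 x * cnj (\<alpha> 3 x) = -1 \<and> \<alpha> 2 x * cnj (\<alpha> 4 x) = -1"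
    using assms(1) unfolding C_plus_lattice_def by blast
  have edge: "edge f i x = \<alpha> i x * s (x + e i) * s x" and s0: "s 0 = 1" for i x
    using s unfolding s_map_def by auto
  have \<alpha>0: "\<alpha> i x \<noteq> 0" for i x
    using cr by (simp add: cross_ratio_system_def)
  have shift: "\<alpha> i (x + e j) = \<alpha> i x" if "i \<noteq> j" for i j x
    using cr that by (simp add: cross_ratio_system_def)
  have snz: "s x \<noteq> 0" for x
  proof -
    have "\<forall>x i j. i \<noteq> j \<longrightarrow> distinct [f x, f (x + e i), f (x + e j), f (x + e i + e j)]"
      using cr unfolding cross_ratio_system_def by (rule conjunct1)
    from this[rule_format, of 1 2 x] have "distinct [f x, f (x + e 1), f (x + e 2), f (x + e 1 + e 2)]"
      by simp
    then have "edge f 1 x \<noteq> 0"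
      by (auto simp: Defs.edge_def)
    then show ?thesis
      unfolding edge by auto
  qed
  have step: "\<forall>\<^sub>F \<tau> in nhds t. \<Phi> (x + e i) \<tau> = transition f \<alpha> i x \<tau> ** \<Phi> x \<tau>"
    and diff: "\<Phi> x differentiable (at t)" and inv: "invertible (\<Phi> x t)" for x i
    using assms(2) unfolding frame_at_def by auto
  have ev_inv: "\<forall>\<^sub>F \<tau> in nhds t. invertible (\<Phi> x \<tau>)" for x
    using diff inv by (intro eventually_invertible differentiable_imp_continuous_within)

  \<comment> \<open>For real \<open>s x\<close> the normalisation says \<open>|k * s x| = 1\<close>.
    One \<open>k\<close> must serve all \<open>\<tau>\<close> near \<open>t\<close>, so that it
    survives differentiation.\<close>
  define good where "good x \<longleftrightarrow> s x \<in> \<real> \<and>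
    (\<exists>k. k * cnj k * (s x)\<^sup>2 = 1 \<and> (\<forall>\<^sub>F \<tau> in nhds t. twisted k (\<Phi> x \<tau>)))" for x
  have good_step: "good x \<longleftrightarrow> good (x + e i + e j)"
    if ij: "i \<noteq> j" and dual: "s (x + e i) * cnj (s (x + e j)) = 1" "\<alpha> i x * cnj (\<alpha> j x) = -1" for x i j
  proof -
    let ?y = "x + e i + e j"
    have comm: "x + e j + e i = ?y"
      by (simp add: algebra_simps)
    have "edge f i x + edge f j (x + e i) = edge f j x + edge f i (x + e j)"
      by (simp add: Defs.edge_def comm)
    then have rel: "s (x + e i) * cnj (s (x + e i)) * (\<alpha> i x * s x + \<alpha> j x * s ?y)
        = \<alpha> j x * s x + \<alpha> i x * s ?y"
      using that unfolding edge by (intro quad_relation) (simp_all add: shift comm)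
    have transport: "(\<forall>\<^sub>F \<tau> in nhds t. twisted (- k * (\<alpha> i x * \<alpha> j x) * s x / s ?y) (\<Phi> ?y \<tau>))
          \<longleftrightarrow> (\<forall>\<^sub>F \<tau> in nhds t. twisted k (\<Phi> x \<tau>))"
      and norm: "(- k * (\<alpha> i x * \<alpha> j x) * s x / s ?y) * cnj (- k * (\<alpha> i x * \<alpha> j x) * s x / s ?y) * (s ?y)\<^sup>2 = 1"
      if real: "s x \<in> \<real>" "s ?y \<in> \<real>" and k: "k * cnj k * (s x)\<^sup>2 = 1" for k
    proof -
      have L: "cis \<tau> * cnj (cis \<tau>) = 1" for \<tau>
        by (simp add: cis_cnj cis_mult)
      note two = two_step_twisted[OF rel dual(2) real snz snz snz k L]
      show "(- k * (\<alpha> i x * \<alpha> j x) * s x / s ?y) * cnj (- k * (\<alpha> i x * \<alpha> j x) * s x / s ?y) * (s ?y)\<^sup>2 = 1"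
        by (rule two(3))
      have "\<forall>\<^sub>F \<tau> in nhds t. twisted (- k * (\<alpha> i x * \<alpha> j x) * s x / s ?y) (\<Phi> ?y \<tau>)
          \<longleftrightarrow> twisted k (\<Phi> x \<tau>)"
        using step[of x i] step[of "x + e i" j] ev_inv[of ?y] ev_inv[of x]
      proof eventually_elim
        case (elim \<tau>)
        let ?M = "transition f \<alpha> j (x + e i) \<tau> ** transition f \<alpha> i x \<tau>"
        have \<Phi>: "\<Phi> ?y \<tau> = ?M ** \<Phi> x \<tau>"
          using elim(1,2) by (simp add: matrix_mul_assoc)
        \<comment> \<open>The determinant of \<open>?M\<close> divides that of the invertible
          \<open>\<Phi> ?y \<tau>\<close>.\<close>
        have inv_M: "invertible ?M"
          using elim(3) unfolding \<Phi> by (simp add: invertible_det_nz det_mul)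
        have T: "?M = (vector
            [vector [cis \<tau>, \<alpha> j x * s ?y * s (x + e i) / cis \<tau>],
             vector [- \<alpha> j x / (s ?y * s (x + e i)) / cis \<tau>, cis \<tau>]] :: complex ^ 2 ^ 2) ** vector
            [vector [cis \<tau>, \<alpha> i x * s (x + e i) * s x / cis \<tau>],
             vector [- \<alpha> i x / (s (x + e i) * s x) / cis \<tau>, cis \<tau>]]"
          unfolding transition_eq[of f _ _ \<alpha> s, OF edge \<alpha>0] shift[OF ij[symmetric]] ..
        show ?case
          unfolding \<Phi> T by (rule twisted_mult_iff[OF two(1,2) inv_M[unfolded T]])
      qed
      then show "(\<forall>\<^sub>F \<tau> in nhds t. twisted (- k * (\<alpha> i x * \<alpha> j x) * s x / s ?y) (\<Phi> ?y \<tau>))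
          \<longleftrightarrow> (\<forall>\<^sub>F \<tau> in nhds t. twisted k (\<Phi> x \<tau>))"
        by (rule eventually_subst)
    qed
    have real_iff: "s x \<in> \<real> \<longleftrightarrow> s ?y \<in> \<real>"
      by (rule quad_real_iff[OF rel dual(2)])
    show ?thesis
    proof
      assume "good x"
      then show "good ?y"
        unfolding good_def using real_iff transport norm by metis
    next
      assume "good ?y"
      then obtain k' where real: "s x \<in> \<real>" "s ?y \<in> \<real>" and k': "k' * cnj k' * (s ?y)\<^sup>2 = 1"
        and tw: "\<forall>\<^sub>F \<tau> in nhds t. twisted k' (\<Phi> ?y \<tau>)"
        unfolding good_def real_iff by blast
      \<comment> \<open>The gauge formula for \<open>k'\<close> solved for \<open>k\<close>; the
        normalisation carries back because \<open>\<alpha> i x * \<alpha> j x\<close> has modulus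
        1.\<close>
      define k where "k = - k' * s ?y / (\<alpha> i x * \<alpha> j x * s x)"
      have k'_eq: "k' = - k * (\<alpha> i x * \<alpha> j x) * s x / s ?y"
        using \<alpha>0 snz by (simp add: k_def)
      have ab: "\<alpha> i x * \<alpha> j x * (cnj (\<alpha> i x) * cnj (\<alpha> j x)) = 1"
        by (rule mult_cnj_mult_eq_1[OF dual(2)])
      have "k * cnj k * (s x)\<^sup>2 = k' * cnj k' * (s ?y)\<^sup>2 / (\<alpha> i x * \<alpha> j x * (cnj (\<alpha> i x) * cnj (\<alpha> j x)))"
        using real \<alpha>0 snz by (simp add: k_def Reals_cnj_iff field_simps power2_eq_square)
      then have "k * cnj k * (s x)\<^sup>2 = 1"
        unfolding k' ab by simp
      then show "good x"
        using real tw transport[of k] unfolding good_def k'_eq by blast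
    qed
  qed
  \<comment> \<open>The gauge at the origin is 1, matching \<open>s 0 = 1\<close>.\<close>
  have "good 0"
    using assms(3) by (auto simp: good_def s0 quaternions_iff_twisted intro!: exI[of _ 1])
  let ?v = "\<lambda>m n :: int. vector [m, n, m, n] :: int ^ 4"
  have v: "?v m n \<in> diagonal" for m n
    by (auto simp: diagonal_def)
  have "?v m n + e 1 + e 3 = ?v (m + 1) n" "?v m n + e 2 + e 4 = ?v m (n + 1)" "?v 0 0 = 0" for m n
    by (simp_all add: vec_eq_iff forall_4 axis_def vector_4)
  note v_simps = this
  have g1: "good (?v m n) \<longleftrightarrow> good (?v (m + 1) n)" and g2: "good (?v m n) \<longleftrightarrow> good (?v m (n + 1))" for m n
    using good_step[of 1 3 "?v m n"] good_step[of 2 4 "?v m n"] diag[OF v[of m n]]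
    by (simp_all add: v_simps)
  \<comment> \<open>A diagonal point is reached from the origin first by quads in directions 1 and
    3, then by quads in directions 2 and 4.\<close>
  have "good (?v m 0)" for m
    by (rule int_iff_Suc_induct[of "\<lambda>m. good (?v m 0)"]) (use \<open>good 0\<close> v_simps g1 in auto)
  then have "good (?v m n)" for m n
    by (rule int_iff_Suc_induct[of "\<lambda>n. good (?v m n)"]) (use g2 in auto)
  then have "\<exists>k. \<forall>\<^sub>F \<tau> in nhds t. twisted k (\<Phi> x \<tau>)" if "x \<in> diagonal" for x
    using that unfolding diagonal_def good_def by blast
  moreover have "associated_family \<Phi> t x \<in> quaternions" if ev: "\<forall>\<^sub>F \<tau> in nhds t. twisted k (\<Phi> x \<tau>)" for x k
  proof -
    let ?D = "vector_derivative (\<Phi> x) (at t)"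
    have "twisted k (\<Phi> x t)"
      using ev by (rule eventually_nhds_x_imp_x)
    moreover have "twisted k (\<Phi> x t ** associated_family \<Phi> t x)"
    proof -
      have "\<Phi> x t ** associated_family \<Phi> t x = ?D"
        by (simp add: associated_family_def matrix_mul_assoc matrix_inv_right[OF inv])
      moreover have "twisted k ?D"
        using ev diff[of x] unfolding vector_derivative_works by (rule twisted_derivative)
      ultimately show ?thesis
        by simp
    qed
    \<comment> \<open>The frame and its derivative share the gauge \<open>k\<close>, so
      \<open>twisted_mult_iff\<close> with right gauge 1 cancels the invertible factor
      \<open>\<Phi> x t\<close>.\<close>
    ultimately show ?thesis
      using twisted_mult_iff[of 1 "\<Phi> x t" k] inv[of x] by (simp add: quaternions_iff_twisted twisted_def)
  qed
  ultimately show ?thesis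
    by blast
qed

end
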